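(* For every coloring $f:\operatorname{FIN}_A\to C$ there is a uniformly recurrent coloring $g:\operatorname{FIN}_A\to C$ which is weakly proximal to $f$.
   Context: Fix a finite nonempty alphabet $A$ and finite nonempty color set $C$. A located word over $A$ is a function from a finite subset of $\mathbb{N}$ into $A$; here the empty located word $\emptyset$ is included, with $\emptyset\cup p=p\cup\emptyset=p$, and $\operatorname{FIN}_A$ denotes the set of located words (a coloring is a function $\operatorname{FIN}_A\to C$). For $p,q$ with $\max\operatorname{dom}p<\min\operatorname{dom}q$, $p\cup q$ is the union of functions. For $m\in\mathbb{N}$, $n\in\mathbb{N}\cup\{\infty\}$, $\operatorname{FIN}_A(m,n)$ is the set of located words $p$ with $\operatorname{dom}p\subseteq[m,n)$. For $\ell\in\mathbb{N}$, $p\in\operatorname{FIN}_A(\ell,\infty)$ and a coloring $f$, $S^\ell_p(f):\operatorname{FIN}_A(0,\ell)\to C$ is $S^\ell_p(f)(q)=f(q\cup p)$, and $S^\ell(f)=S^\ell_\emptyset(f)$. A coloring $f$ is uniformly recurrent if for every $\ell$ there is $m>\ell$ such that for every $p\in\operatorname{FIN}_A(m,\infty)$ there is $q\in\operatorname{FIN}_A(\ell,m)$ with $S^\ell(f)=S^\ell_{q\cup p}(f)$. Colorings $f,g$ are weakly proximal if for every $\ell$ there is $p\in\operatorname{FIN}_A(\ell,\infty)$ with $S^\ell_p(g)=S^\ell_p(f)$. *)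

theory Defs
  imports Main "HOL-Library.FuncSet" "HOL-Library.Extended_Nat"
begin

text \<open>A located word over \<open>A\<close> is a finite partial map from \<open>nat\<close> to \<open>A\<close>; the empty located word
  is \<open>Map.empty\<close>. On maps with disjoint domains, \<open>q ++ p\<close> is the union of \<open>q\<close> and \<open>p\<close>.\<close>

definition located_words :: "'a set \<Rightarrow> (nat \<rightharpoonup> 'a) set" where
  "located_words A = {p. finite (dom p) \<and> ran p \<subseteq> A}"

definition located_words_in :: "'a set \<Rightarrow> nat \<Rightarrow> enat \<Rightarrow> (nat \<rightharpoonup> 'a) set" where
  "located_words_in A m n = {p \<in> located_words A. dom p \<subseteq> {i. m \<le> i \<and> enat i < n}}"

definition colorings :: "'a set \<Rightarrow> 'c set \<Rightarrow> ((nat \<rightharpoonup> 'a) \<Rightarrow> 'c) set" where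
  "colorings A C = located_words A \<rightarrow>\<^sub>E C"

text \<open>The restriction to the words on \<open>[0,l)\<close> makes equality of two such functions mean agreement
  on exactly those words.\<close>

definition shift ::
  "'a set \<Rightarrow> nat \<Rightarrow> (nat \<rightharpoonup> 'a) \<Rightarrow> ((nat \<rightharpoonup> 'a) \<Rightarrow> 'c) \<Rightarrow> ((nat \<rightharpoonup> 'a) \<Rightarrow> 'c)" where
  "shift A l p f = restrict (\<lambda>q. f (q ++ p)) (located_words_in A 0 (enat l))"

definition uniformly_recurrent :: "'a set \<Rightarrow> ((nat \<rightharpoonup> 'a) \<Rightarrow> 'c) \<Rightarrow> bool" where
  "uniformly_recurrent A f \<longleftrightarrow>
    (\<forall>l. \<exists>m>l. \<forall>p \<in> located_words_in A m \<infinity>. \<exists>q \<in> located_words_in A l (enat m).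
      shift A l Map.empty f = shift A l (q ++ p) f)"

definition weakly_proximal ::
  "'a set \<Rightarrow> ((nat \<rightharpoonup> 'a) \<Rightarrow> 'c) \<Rightarrow> ((nat \<rightharpoonup> 'a) \<Rightarrow> 'c) \<Rightarrow> bool" where
  "weakly_proximal A f g \<longleftrightarrow>
    (\<forall>l. \<exists>p \<in> located_words_in A l \<infinity>. shift A l p g = shift A l p f)"

end

theory Submission
  imports Defs "HOL-Analysis.T1_Spaces"
begin

text \<open>
  Located words act on colorings by \<open>(p \<cdot> f) q = f (q ++ p)\<close>. The pointwise limits of these maps
  along words with minimum tending to infinity form a compact right topological semigroup \<open>E\<close>
  (an Ellis semigroup). Let \<open>u\<close> be an idempotent in a minimal left ideal of \<open>E\<close> and \<open>g = u f\<close>.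
  Then \<open>u g = u f = g\<close>, so a single word approximating \<open>u\<close> at both \<open>f\<close> and \<open>g\<close> witnesses weak
  proximality. If uniform recurrence of \<open>g\<close> failed at \<open>l\<close>, the bad words would accumulate at some
  \<open>v\<close> in \<open>E\<close> such that no \<open>w (v g)\<close> agrees with \<open>g\<close> on the words below \<open>l\<close>; but minimality gives a
  \<open>w\<close> with \<open>w v u = u\<close>, hence \<open>w (v g) = g\<close>.
\<close>

section \<open>Compact right topological semigroups\<close>

text \<open>Zorn's lemma for reverse inclusion. A finite nonempty subfamily of a chain has its
  intersection as a member, so compactness makes the intersection of the whole chain
  nonempty.\<close>

lemma compact_space_minimal_closed:
  assumes "compact_space X" and "\<F> \<noteq> {}"
    and closed: "\<And>S. S \<in> \<F> \<Longrightarrow> closedin X S" and nonempty: "{} \<notin> \<F>"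
    and Inter: "\<And>\<C>. \<C> \<noteq> {} \<Longrightarrow> \<C> \<subseteq> \<F> \<Longrightarrow> \<Inter>\<C> \<noteq> {} \<Longrightarrow> \<Inter>\<C> \<in> \<F>"
  obtains M where "M \<in> \<F>" and "\<And>S. S \<in> \<F> \<Longrightarrow> S \<subseteq> M \<Longrightarrow> S = M"
proof -
  have "\<exists>M\<in>\<F>. \<forall>S\<in>\<F>. M \<supseteq> S \<longrightarrow> S = M"
  proof (rule predicate_Zorn)
    show "partial_order_on \<F> (relation_of (\<lambda>S T. S \<supseteq> T) \<F>)"
      by (rule partial_order_on_relation_ofI) auto
    show "\<exists>U\<in>\<F>. \<forall>S\<in>\<C>. S \<supseteq> U" if "\<C> \<in> Chains (relation_of (\<lambda>S T. S \<supseteq> T) \<F>)" for \<C>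
    proof (cases "\<C> = {}")
      case True
      with \<open>\<F> \<noteq> {}\<close> show ?thesis by blast
    next
      case False
      have sub: "\<C> \<subseteq> \<F>" and chain: "subset.chain \<F> \<C>"
        using that by (auto simp: Chains_def relation_of_def subset_chain_def)
      have "\<Inter>\<G> \<noteq> {}" if "finite \<G>" "\<G> \<subseteq> \<C>" for \<G>
      proof (cases "\<G> = {}")
        case False
        have "subset.chain \<F> \<G>"
          using chain that unfolding subset_chain_def by blast
        with False that have "\<Inter>\<G> \<in> \<G>"
          by (intro Inter_in_chain)
        with that sub nonempty show ?thesis by (metis subsetD)
      qed auto
      then have "\<Inter>\<C> \<noteq> {}"
        using \<open>compact_space X\<close> closed sub unfolding compact_space_fip by (meson subsetD)
      with Inter False sub show ?thesis by (meson Inter_lower)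
    qed
  qed
  with that show thesis by blast
qed

locale compact_right_topological_semigroup =
  fixes X :: "'a topology" and mult :: "'a \<Rightarrow> 'a \<Rightarrow> 'a" (infixl "\<odot>" 70)
  assumes compact: "compact_space X" and Hausdorff: "Hausdorff_space X"
    and mult_closed: "u \<in> topspace X \<Longrightarrow> v \<in> topspace X \<Longrightarrow> u \<odot> v \<in> topspace X"
    and mult_assoc: "u \<in> topspace X \<Longrightarrow> v \<in> topspace X \<Longrightarrow> w \<in> topspace X \<Longrightarrow>
      (u \<odot> v) \<odot> w = u \<odot> (v \<odot> w)"
    and continuous_mult_left: "v \<in> topspace X \<Longrightarrow> continuous_map X X (\<lambda>u. u \<odot> v)"
begin

lemma closedin_mult_image:
  assumes "closedin X S" "v \<in> topspace X"
  shows "closedin X ((\<lambda>u. u \<odot> v) ` S)"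
  using assms compact Hausdorff continuous_mult_left
  by (meson closedin_compact_space compactin_imp_closedin image_compactin)

text \<open>The Ellis-Numakura lemma. For \<open>e\<close> in a minimal closed subsemigroup
  \<open>M\<close>, minimality forces first that right translation by \<open>e\<close> maps
  \<open>M\<close> onto itself, and then that \<open>u \<odot> e = e\<close> for every
  \<open>u\<close> in \<open>M\<close>, in particular for \<open>u = e\<close>.\<close>

lemma idempotent_exists:
  assumes "closedin X S" "S \<noteq> {}" and "\<And>u v. u \<in> S \<Longrightarrow> v \<in> S \<Longrightarrow> u \<odot> v \<in> S"
  obtains e where "e \<in> S" "e \<odot> e = e"
proof -
  define \<F> where "\<F> = {T. closedin X T \<and> T \<noteq> {} \<and> T \<subseteq> S \<and> (\<forall>u\<in>T. \<forall>v\<in>T. u \<odot> v \<in> T)}"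
  obtain M where "M \<in> \<F>" and min: "\<And>T. T \<in> \<F> \<Longrightarrow> T \<subseteq> M \<Longrightarrow> T = M"
  proof (rule compact_space_minimal_closed[OF compact])
    show "\<F> \<noteq> {}"
      using assms by (auto simp: \<F>_def)
    show "\<Inter>\<C> \<in> \<F>" if "\<C> \<noteq> {}" "\<C> \<subseteq> \<F>" "\<Inter>\<C> \<noteq> {}" for \<C>
    proof -
      have "closedin X (\<Inter>\<C>)"
        using that by (intro closedin_Inter) (auto simp: \<F>_def)
      with that show ?thesis
        unfolding \<F>_def by blast
    qed
  qed (auto simp: \<F>_def)
  then have M: "closedin X M" "M \<noteq> {}" "M \<subseteq> S" "\<And>u v. u \<in> M \<Longrightarrow> v \<in> M \<Longrightarrow> u \<odot> v \<in> M"
    by (auto simp: \<F>_def)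
  then have top: "\<And>u. u \<in> M \<Longrightarrow> u \<in> topspace X"
    using closedin_subset by blast
  obtain e where e: "e \<in> M"
    using M by blast
  have "(\<lambda>u. u \<odot> e) ` M \<in> \<F>"
    unfolding \<F>_def
  proof (intro CollectI conjI ballI)
    show "x \<odot> y \<in> (\<lambda>u. u \<odot> e) ` M" if xy: "x \<in> (\<lambda>u. u \<odot> e) ` M" "y \<in> (\<lambda>u. u \<odot> e) ` M" for x y
    proof -
      obtain a b where ab: "a \<in> M" "b \<in> M" "x = a \<odot> e" "y = b \<odot> e"
        using xy by blast
      then have "x \<odot> y = (a \<odot> e \<odot> b) \<odot> e"
        using M(4) e top by (simp add: mult_assoc)
      with ab e M(4) show ?thesis by blast
    qed
  qed (use M e top closedin_mult_image in auto)
  then have "(\<lambda>u. u \<odot> e) ` M = M"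
    using M(4) e by (intro min) auto
  then have ne: "{u \<in> M. u \<odot> e = e} \<noteq> {}"
    using e by (metis (mono_tags, lifting) empty_iff imageE mem_Collect_eq)
  \<comment> \<open>Membership in \<open>{e}\<close> exhibits the solution set as a preimage of a
    closed set under right translation.\<close>
  have "closedin X {u \<in> M. u \<odot> e \<in> {e}}"
    using M(1) e top Hausdorff
    by (intro closedin_continuous_map_preimage_gen[OF continuous_mult_left] closedin_Hausdorff_singleton)
      auto
  then have "{u \<in> M. u \<odot> e = e} \<in> \<F>"
    using ne M e top by (auto simp: \<F>_def mult_assoc)
  then have "{u \<in> M. u \<odot> e = e} = M"
    by (intro min) auto
  with e M(3) show thesis
    by (intro that[of e]) auto
qed

text \<open>For \<open>u\<close> in a minimal closed left ideal the products
  \<open>s \<odot> u\<close> form a closed left ideal inside it, hence all of it. So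
  \<open>s \<odot> u = t\<close> can be solved for \<open>s\<close> whenever \<open>u\<close> and
  \<open>t\<close> lie in \<open>L\<close>.\<close>

lemma minimal_left_ideal_exists:
  assumes "topspace X \<noteq> {}"
  obtains L where "closedin X L" "L \<noteq> {}"
    and "\<And>s u. s \<in> topspace X \<Longrightarrow> u \<in> L \<Longrightarrow> s \<odot> u \<in> L"
    and "\<And>u. u \<in> L \<Longrightarrow> (\<lambda>s. s \<odot> u) ` topspace X = L"
proof -
  define \<F> where
    "\<F> = {T. closedin X T \<and> T \<noteq> {} \<and> (\<forall>s\<in>topspace X. \<forall>u\<in>T. s \<odot> u \<in> T)}"
  obtain L where "L \<in> \<F>" and min: "\<And>T. T \<in> \<F> \<Longrightarrow> T \<subseteq> L \<Longrightarrow> T = L"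
  proof (rule compact_space_minimal_closed[OF compact])
    show "\<F> \<noteq> {}"
      using assms mult_closed by (auto simp: \<F>_def)
    show "\<Inter>\<C> \<in> \<F>" if "\<C> \<noteq> {}" "\<C> \<subseteq> \<F>" "\<Inter>\<C> \<noteq> {}" for \<C>
    proof -
      have "closedin X (\<Inter>\<C>)"
        using that by (intro closedin_Inter) (auto simp: \<F>_def)
      with that show ?thesis
        unfolding \<F>_def by blast
    qed
  qed (auto simp: \<F>_def)
  then have L: "closedin X L" "L \<noteq> {}" "\<And>s u. s \<in> topspace X \<Longrightarrow> u \<in> L \<Longrightarrow> s \<odot> u \<in> L"
    by (auto simp: \<F>_def)
  have "(\<lambda>s. s \<odot> u) ` topspace X = L" if "u \<in> L" for u
  proof (rule min)
    have u: "u \<in> topspace X"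
      using that L(1) closedin_subset by blast
    show "(\<lambda>s. s \<odot> u) ` topspace X \<subseteq> L"
      using L(3) that by blast
    have "s \<odot> (t \<odot> u) \<in> (\<lambda>s. s \<odot> u) ` topspace X" if "s \<in> topspace X" "t \<in> topspace X" for s t
      using that u mult_closed by (intro image_eqI[of _ _ "s \<odot> t"]) (auto simp: mult_assoc)
    then show "(\<lambda>s. s \<odot> u) ` topspace X \<in> \<F>"
      using assms u closedin_mult_image[OF closedin_topspace] by (auto simp: \<F>_def)
  qed
  with L that show thesis by blast
qed

end

section \<open>The action of located words on colorings\<close>

lemma located_words_in_mono:
  "l' \<le> l \<Longrightarrow> n \<le> n' \<Longrightarrow> located_words_in A l n \<subseteq> located_words_in A l' n'"
  by (fastforce simp: located_words_in_def)

lemma located_words_in_subset: "located_words_in A l n \<subseteq> located_words A"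
  by (auto simp: located_words_in_def)

lemma located_words_map_add:
  "p \<in> located_words A \<Longrightarrow> q \<in> located_words A \<Longrightarrow> p ++ q \<in> located_words A"
  by (auto simp: located_words_def ran_def map_add_Some_iff)

text \<open>On overlapping domains the right operand of \<open>++\<close> wins, so the words need
  not be ordered: each interval, in particular each tail, yields a semigroup under
  \<open>++\<close>.\<close>

lemma located_words_in_map_add:
  "p \<in> located_words_in A l n \<Longrightarrow> q \<in> located_words_in A l n \<Longrightarrow> p ++ q \<in> located_words_in A l n"
  using located_words_map_add by (fastforce simp: located_words_in_def)

lemma empty_in_located_words_in: "Map.empty \<in> located_words_in A l n"
  by (auto simp: located_words_in_def located_words_def)

lemma finite_located_words_in:
  assumes "finite A"
  shows "finite (located_words_in A l (enat n))"
proof (rule finite_subset)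
  show "located_words_in A l (enat n) \<subseteq> (\<Union>D\<in>Pow {..<n}. {p. dom p = D \<and> ran p \<subseteq> A})"
    by (auto simp: located_words_in_def located_words_def)
  show "finite (\<Union>D\<in>Pow {..<n}. {p :: nat \<rightharpoonup> 'a. dom p = D \<and> ran p \<subseteq> A})"
    using assms finite_subset[OF _ finite_lessThan[of n]] by (auto intro!: finite_set_of_finite_maps)
qed

lemma located_words_in_bounded:
  assumes "p \<in> located_words_in A l \<infinity>"
  obtains m where "m > l" "p \<in> located_words_in A l (enat m)"
proof -
  have "finite (dom p)"
    using assms by (auto simp: located_words_in_def located_words_def)
  then obtain k where "\<forall>i\<in>dom p. i < k"
    unfolding finite_nat_set_iff_bounded by blast
  \<comment> \<open>The \<open>Suc l\<close> secures \<open>m > l\<close> even when \<open>p\<close>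
    is empty.\<close>
  then have "p \<in> located_words_in A l (enat (max k (Suc l)))"
    using assms by (simp add: located_words_in_def subset_iff less_max_iff_disj)
  then show thesis
    by (intro that[of "max k (Suc l)"]) auto
qed

lemma shift_eq_iff:
  "shift A l p f = shift A l p' f' \<longleftrightarrow>
    (\<forall>q\<in>located_words_in A 0 (enat l). f (q ++ p) = f' (q ++ p'))"
  unfolding shift_def by (auto simp: restrict_def fun_eq_iff)

section \<open>Colorings and their self-maps under pointwise convergence\<close>

locale finite_coloring =
  fixes A :: "'a set" and C :: "'c set"
  assumes finite_A: "finite A" and finite_C: "finite C"
begin

abbreviation W where "W \<equiv> located_words A"
abbreviation X where "X \<equiv> colorings A C"
abbreviation tail where "tail l \<equiv> located_words_in A l \<infinity>"

text \<open>Restriction in both arguments puts \<open>act p\<close>, for \<open>p\<close> in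
  \<open>W\<close>, into the extensional function spaces that carry the product topologies.\<close>

definition act :: "(nat \<rightharpoonup> 'a) \<Rightarrow> ((nat \<rightharpoonup> 'a) \<Rightarrow> 'c) \<Rightarrow> ((nat \<rightharpoonup> 'a) \<Rightarrow> 'c)" where
  "act p = (\<lambda>f\<in>X. \<lambda>q\<in>W. f (q ++ p))"

definition coloring_topology :: "((nat \<rightharpoonup> 'a) \<Rightarrow> 'c) topology" where
  "coloring_topology = product_topology (\<lambda>_. discrete_topology C) W"

definition map_topology :: "(((nat \<rightharpoonup> 'a) \<Rightarrow> 'c) \<Rightarrow> ((nat \<rightharpoonup> 'a) \<Rightarrow> 'c)) topology" where
  "map_topology = product_topology (\<lambda>_. coloring_topology) X"

text \<open>The empty word lies in every tail, so the identity on \<open>X\<close> is an idempotent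
  here. This is why the idempotent is later taken in a minimal left ideal.\<close>

definition ellis :: "(((nat \<rightharpoonup> 'a) \<Rightarrow> 'c) \<Rightarrow> ((nat \<rightharpoonup> 'a) \<Rightarrow> 'c)) set" where
  "ellis = (\<Inter>l. map_topology closure_of (act ` tail l))"

lemma topspace_coloring_topology: "topspace coloring_topology = X"
  by (simp add: coloring_topology_def colorings_def)

lemma topspace_map_topology: "topspace map_topology = X \<rightarrow>\<^sub>E X"
  by (simp add: map_topology_def topspace_coloring_topology)

lemma compact_map_topology: "compact_space map_topology"
  using finite_C
  by (auto simp: map_topology_def coloring_topology_def compact_space_product_topology
      compact_space_discrete_topology)

lemma Hausdorff_map_topology: "Hausdorff_space map_topology"
  by (simp add: map_topology_def coloring_topology_def Hausdorff_space_product_topology)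

lemma act_apply: "f \<in> X \<Longrightarrow> q \<in> W \<Longrightarrow> act p f q = f (q ++ p)"
  by (simp add: act_def)

lemma act_in_X: "p \<in> W \<Longrightarrow> f \<in> X \<Longrightarrow> act p f \<in> X"
  by (auto simp: act_def colorings_def PiE_iff located_words_map_add)

lemma act_in_topspace: "p \<in> W \<Longrightarrow> act p \<in> topspace map_topology"
  using act_in_X by (auto simp: topspace_map_topology act_def)

text \<open>Associativity of \<open>++\<close>; the order of the factors is kept because a word acts
  by being appended on the right.\<close>

lemma compose_act:
  assumes "p \<in> W" "r \<in> W"
  shows "compose X (act p) (act r) = act (p ++ r)"
proof
  fix f show "compose X (act p) (act r) f = act (p ++ r) f"
  proof (cases "f \<in> X")
    case True
    then have "act r f \<in> X"
      using assms act_in_X by blast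
    with True assms show ?thesis
      by (auto simp: compose_def act_def located_words_map_add map_add_assoc)
  qed (simp add: compose_def act_def)
qed

text \<open>The coordinate of \<open>compose X u v\<close> at \<open>x\<close> is the coordinate of
  \<open>u\<close> at \<open>v x\<close>: a projection, even if \<open>v\<close> is
  discontinuous.\<close>

lemma continuous_compose_left:
  assumes "v \<in> topspace map_topology"
  shows "continuous_map map_topology map_topology (\<lambda>u. compose X u v)"
proof -
  have "continuous_map map_topology coloring_topology (\<lambda>u. compose X u v x)" if "x \<in> X" for x
  proof -
    have "v x \<in> X"
      using assms that by (auto simp: topspace_map_topology)
    then have "continuous_map map_topology coloring_topology (\<lambda>u. u (v x))"
      unfolding map_topology_def by (rule continuous_map_product_coordinates)
    with that show ?thesis
      by (simp add: compose_def)
  qed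
  then show ?thesis
    by (subst (2) map_topology_def) (auto simp: continuous_map_componentwise compose_def)
qed

lemma continuous_evaluation:
  assumes "x \<in> X" "q \<in> W"
  shows "continuous_map map_topology (discrete_topology C) (\<lambda>u. u x q)"
proof -
  have "continuous_map map_topology coloring_topology (\<lambda>u. u x)"
    unfolding map_topology_def using assms(1) by (rule continuous_map_product_coordinates)
  moreover have "continuous_map coloring_topology (discrete_topology C) (\<lambda>f. f q)"
    unfolding coloring_topology_def using assms(2) by (rule continuous_map_product_coordinates)
  ultimately show ?thesis
    using continuous_map_compose by (fastforce simp: o_def)
qed

text \<open>Composing on the left with an arbitrary map need not be continuous. With
  \<open>act p\<close> it is, since the value at \<open>x\<close> and \<open>q\<close> is just
  \<open>v x (q ++ p)\<close>.\<close>

lemma continuous_compose_act: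
  assumes "p \<in> W"
  shows "continuous_map map_topology map_topology (\<lambda>v. compose X (act p) v)"
proof -
  have "continuous_map map_topology (discrete_topology C) (\<lambda>v. act p (v x) q)"
    if "x \<in> X" "q \<in> W" for x q
  proof (rule continuous_map_eq)
    show "continuous_map map_topology (discrete_topology C) (\<lambda>v. v x (q ++ p))"
      using that assms by (intro continuous_evaluation located_words_map_add)
    show "v x (q ++ p) = act p (v x) q" if "v \<in> topspace map_topology" for v
      using that \<open>x \<in> X\<close> \<open>q \<in> W\<close> by (subst act_apply) (auto simp: topspace_map_topology)
  qed
  moreover have "act p (v x) \<in> extensional W" if "x \<in> X" "v \<in> topspace map_topology" for v x
  proof -
    have "v x \<in> X"
      using that by (auto simp: topspace_map_topology)
    then have "act p (v x) \<in> X"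
      using assms act_in_X by blast
    then show ?thesis
      by (auto simp: colorings_def PiE_def)
  qed
  ultimately have "continuous_map map_topology coloring_topology (\<lambda>v. act p (v x))"
    if "x \<in> X" for x
    using that by (subst coloring_topology_def) (auto simp: continuous_map_componentwise)
  then show ?thesis
    by (subst (2) map_topology_def) (auto simp: continuous_map_componentwise compose_def)
qed

section \<open>The Ellis semigroup\<close>

text \<open>Two successive limits: first the left factor is some \<open>act p\<close> and
  \<open>v\<close> is a limit, by \<open>continuous_compose_act\<close>; then \<open>v\<close> is
  fixed and the left factor tends to \<open>u\<close>, by
  \<open>continuous_compose_left\<close>.\<close>

lemma closure_tail_compose:
  assumes u: "u \<in> map_topology closure_of (act ` tail l)"
    and v: "v \<in> map_topology closure_of (act ` tail l)"
  shows "compose X u v \<in> map_topology closure_of (act ` tail l)"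
proof -
  let ?K = "map_topology closure_of (act ` tail l)"
  have tailW: "p \<in> W" if "p \<in> tail l" for p
    using that located_words_in_subset by blast
  have step: "compose X (act p) v \<in> ?K" if "p \<in> tail l" for p
  proof -
    have "compose X (act p) v \<in> map_topology closure_of (compose X (act p) ` act ` tail l)"
      using continuous_map_image_closure_subset[OF continuous_compose_act] tailW that v by blast
    moreover have "compose X (act p) ` act ` tail l \<subseteq> act ` tail l"
      using that tailW by (auto simp: compose_act intro!: imageI located_words_in_map_add)
    ultimately show ?thesis
      using closure_of_mono by blast
  qed
  have "v \<in> topspace map_topology"
    using v by (simp add: in_closure_of)
  then have "compose X u v \<in> map_topology closure_of ((\<lambda>u. compose X u v) ` act ` tail l)"
    using continuous_map_image_closure_subset[OF continuous_compose_left] u by blast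
  moreover have "(\<lambda>u. compose X u v) ` act ` tail l \<subseteq> ?K"
    using step by blast
  ultimately show ?thesis
    using closure_of_minimal[OF _ closedin_closure_of] by blast
qed

lemma ellis_closed: "closedin map_topology ellis"
  unfolding ellis_def by (intro closedin_Inter) auto

lemma ellis_subset: "ellis \<subseteq> X \<rightarrow>\<^sub>E X"
  using closedin_subset[OF ellis_closed] by (simp add: topspace_map_topology)

text \<open>Stated for general \<open>P\<close> since it serves twice: for the tails, and for the
  bad words in the recurrence argument.\<close>

lemma nested_closures_meet:
  assumes "\<And>m. P m \<noteq> {}" and "decseq P" and "\<And>m. P m \<subseteq> W"
  shows "(\<Inter>m. map_topology closure_of (act ` P m)) \<noteq> {}"
proof (rule compact_space_imp_nest[OF compact_map_topology])
  show "map_topology closure_of (act ` P m) \<noteq> {}" for m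
  proof -
    have "act ` P m \<subseteq> topspace map_topology"
      using assms(3) act_in_topspace by blast
    with assms(1) show ?thesis
      by (simp add: closure_of_eq_empty)
  qed
  show "decseq (\<lambda>m. map_topology closure_of (act ` P m))"
    using assms(2) by (auto simp: decseq_def intro!: closure_of_mono image_mono)
qed auto

lemma ellis_nonempty: "ellis \<noteq> {}"
  unfolding ellis_def
proof (rule nested_closures_meet)
  show "tail m \<noteq> {}" for m
    using empty_in_located_words_in by blast
  show "decseq tail"
    unfolding decseq_def by (intro allI impI located_words_in_mono order_refl)
  show "tail m \<subseteq> W" for m
    by (rule located_words_in_subset)
qed

lemma topspace_ellis: "topspace (subtopology map_topology ellis) = ellis"
  using ellis_closed closedin_subset by fastforce

sublocale ellis: compact_right_topological_semigroup "subtopology map_topology ellis" "compose X"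
proof
  show "compact_space (subtopology map_topology ellis)"
    by (simp add: closedin_compact_space compact_map_topology compact_space_subtopology ellis_closed)
  show "Hausdorff_space (subtopology map_topology ellis)"
    by (simp add: Hausdorff_map_topology Hausdorff_space_subtopology)
  show closed: "compose X u v \<in> topspace (subtopology map_topology ellis)"
    if "u \<in> topspace (subtopology map_topology ellis)" "v \<in> topspace (subtopology map_topology ellis)"
    for u v
    using that closure_tail_compose unfolding topspace_ellis by (auto simp: ellis_def)
  show "compose X (compose X u v) w = compose X u (compose X v w)"
    if "w \<in> topspace (subtopology map_topology ellis)" for u v w
  proof -
    have "w \<in> X \<rightarrow> X"
      using that ellis_subset by auto
    then show ?thesis
      by (metis compose_assoc)
  qed
  show "continuous_map (subtopology map_topology ellis) (subtopology map_topology ellis)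
      (\<lambda>u. compose X u v)" if "v \<in> topspace (subtopology map_topology ellis)" for v
  proof -
    have "v \<in> topspace map_topology"
      using that by simp
    then show ?thesis
      using that closed continuous_compose_left[of v]
      by (intro continuous_map_into_subtopology continuous_map_from_subtopology) (auto simp: topspace_ellis)
  qed
qed

text \<open>A basic neighbourhood of \<open>u\<close> fixes finitely many values
  \<open>u x q\<close>, and as \<open>A\<close> is finite only finitely many \<open>q\<close> live
  on \<open>[0, n)\<close>. One word thus matches \<open>u\<close> on all of \<open>Y\<close> at
  once.\<close>

lemma closure_approximation:
  assumes u: "u \<in> map_topology closure_of (act ` P)"
    and "finite Y" "Y \<subseteq> X"
  obtains p where "p \<in> P"
    and "\<And>x q. x \<in> Y \<Longrightarrow> q \<in> located_words_in A 0 (enat n) \<Longrightarrow> u x q = x (q ++ p)"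
proof -
  let ?Q = "located_words_in A 0 (enat n)"
  let ?N = "\<lambda>(x, q). {w \<in> topspace map_topology. w x q \<in> {u x q}}"
  have utop: "u \<in> topspace map_topology"
    using u by (simp add: in_closure_of)
  have QW: "q \<in> W" if "q \<in> ?Q" for q
    using that located_words_in_subset by blast
  have "openin map_topology (?N (x, q))" if "x \<in> Y" "q \<in> ?Q" for x q
  proof -
    have "x \<in> X" "q \<in> W"
      using that assms QW by auto
    then have "u x \<in> X"
      using utop by (auto simp: topspace_map_topology)
    then have "u x q \<in> C"
      using \<open>q \<in> W\<close> by (auto simp: colorings_def)
    with \<open>x \<in> X\<close> \<open>q \<in> W\<close> show ?thesis
      unfolding prod.case
      by (intro openin_continuous_map_preimage[OF continuous_evaluation]) auto
  qed
  \<comment> \<open>Intersecting with the whole space keeps the set open when \<open>Y\<close> is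
    empty.\<close>
  then have "openin map_topology (topspace map_topology \<inter> \<Inter>(?N ` (Y \<times> ?Q)))"
    using \<open>finite Y\<close> finite_located_words_in[OF finite_A]
    by (intro openin_Int_Inter) (auto simp: finite_cartesian_product)
  moreover have "u \<in> topspace map_topology \<inter> \<Inter>(?N ` (Y \<times> ?Q))"
    using utop by auto
  ultimately obtain p where p: "p \<in> P" "act p \<in> \<Inter>(?N ` (Y \<times> ?Q))"
    using u unfolding in_closure_of by blast
  have "u x q = x (q ++ p)" if "x \<in> Y" "q \<in> ?Q" for x q
  proof -
    have "act p x q = u x q"
      using p(2) that by blast
    moreover have "act p x q = x (q ++ p)"
      using that QW assms by (intro act_apply) auto
    ultimately show ?thesis by simp
  qed
  with p(1) that show thesis by blast
qed

end

section \<open>Existence of uniformly recurrent weakly proximal colorings\<close>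

context finite_coloring
begin

lemma weakly_proximal_idempotent:
  assumes "u \<in> ellis" "compose X u u = u" "f \<in> X"
  shows "weakly_proximal A (u f) f"
  unfolding weakly_proximal_def shift_eq_iff
proof
  fix l
  have uf: "u f \<in> X" "u (u f) = u f"
    using assms ellis_subset by (auto simp: compose_def dest: fun_cong[of _ _ f])
  have "u \<in> map_topology closure_of (act ` tail l)"
    using assms by (auto simp: ellis_def)
  then obtain p where "p \<in> tail l"
    and "\<And>x q. x \<in> {f, u f} \<Longrightarrow> q \<in> located_words_in A 0 (enat l) \<Longrightarrow> u x q = x (q ++ p)"
    by (rule closure_approximation[of _ _ "{f, u f}" l]) (use uf assms in auto)
  \<comment> \<open>Here \<open>u f q = f (q ++ p)\<close> and
    \<open>u (u f) q = u f (q ++ p)\<close>; the left sides agree by idempotence.\<close>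
  with uf show "\<exists>p\<in>tail l. \<forall>q\<in>located_words_in A 0 (enat l). f (q ++ p) = u f (q ++ p)"
    by (metis insertCI)
qed

lemma uniformly_recurrent_if_returns:
  assumes g: "g \<in> X" and returns: "\<And>v. v \<in> ellis \<Longrightarrow> \<exists>w\<in>ellis. w (v g) = g"
  shows "uniformly_recurrent A g"
proof (rule ccontr)
  assume "\<not> uniformly_recurrent A g"
  then obtain l where l: "\<And>m. m > l \<Longrightarrow> \<exists>p\<in>tail m. \<forall>q\<in>located_words_in A l (enat m).
      shift A l Map.empty g \<noteq> shift A l (q ++ p) g"
    unfolding uniformly_recurrent_def by blast
  define P where "P m = {p \<in> tail m. \<forall>q\<in>located_words_in A l (enat m).
      shift A l Map.empty g \<noteq> shift A l (q ++ p) g}" for m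
  \<comment> \<open>As \<open>m\<close> grows the tail shrinks and more \<open>q\<close> must fail,
    so being bad becomes more restrictive.\<close>
  have dec: "decseq P"
  proof (rule decseq_SucI)
    show "P (Suc m) \<subseteq> P m" for m
      using located_words_in_mono[of m "Suc m" \<infinity> \<infinity> A]
        located_words_in_mono[of l l "enat m" "enat (Suc m)" A]
      by (auto simp: P_def)
  qed
  \<comment> \<open>Bad words are given only for \<open>m > l\<close>; smaller indices inherit them
    by monotonicity.\<close>
  have "P m \<noteq> {}" for m
  proof -
    have "P (max m (Suc l)) \<noteq> {}"
      using l[of "max m (Suc l)"] unfolding P_def by fastforce
    then show ?thesis
      using decseqD[OF dec, of m "max m (Suc l)"] by auto
  qed
  moreover have "P m \<subseteq> W" for m
    using located_words_in_subset by (fastforce simp: P_def)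
  ultimately have "(\<Inter>m. map_topology closure_of (act ` P m)) \<noteq> {}"
    using dec by (intro nested_closures_meet)
  then obtain v where v: "\<And>m. v \<in> map_topology closure_of (act ` P m)"
    by blast
  have "v \<in> map_topology closure_of (act ` tail m)" for m
    using v[of m] closure_of_mono[of "act ` P m" "act ` tail m"] by (auto simp: P_def)
  then have "v \<in> ellis"
    by (simp add: ellis_def)
  then obtain w where w: "w \<in> ellis" "w (v g) = g"
    using returns by blast
  have "v g \<in> X"
    using \<open>v \<in> ellis\<close> ellis_subset g by auto
  have "w \<in> map_topology closure_of (act ` tail l)"
    using w by (auto simp: ellis_def)
  then obtain q where q: "q \<in> tail l"
    and wq: "\<And>x r. x \<in> {v g} \<Longrightarrow> r \<in> located_words_in A 0 (enat l) \<Longrightarrow> w x r = x (r ++ q)"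
    by (rule closure_approximation[of _ _ "{v g}" l]) (use \<open>v g \<in> X\<close> in auto)
  \<comment> \<open>The order of choices matters: \<open>q\<close> comes from \<open>w\<close>, then
    \<open>m\<close> bounds \<open>q\<close>, and only then is the bad word \<open>p\<close> chosen
    to match \<open>v\<close> on \<open>[0, m)\<close>, where every \<open>r ++ q\<close> lives.
    This is possible because \<open>v\<close> is in the closure for every \<open>m\<close>.\<close>
  obtain m where m: "m > l" "q \<in> located_words_in A l (enat m)"
    using q located_words_in_bounded by blast
  obtain p where p: "p \<in> P m"
    and vp: "\<And>x r. x \<in> {g} \<Longrightarrow> r \<in> located_words_in A 0 (enat m) \<Longrightarrow> v x r = x (r ++ p)"
    using v[of m] by (rule closure_approximation[of _ _ "{g}" m]) (use g in auto)
  \<comment> \<open>The chain is \<open>g r = w (v g) r = v g (r ++ q) = g ((r ++ q) ++ p)\<close>,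
    so \<open>q\<close> refutes the badness of \<open>p\<close>.\<close>
  have "g (r ++ Map.empty) = g (r ++ (q ++ p))" if "r \<in> located_words_in A 0 (enat l)" for r
  proof -
    have "r ++ q \<in> located_words_in A 0 (enat m)"
      using that m located_words_in_mono[of 0 0 "enat l" "enat m" A]
        located_words_in_mono[of 0 l "enat m" "enat m" A]
      by (intro located_words_in_map_add) auto
    then show ?thesis
      using wq[of "v g" r] vp[of g "r ++ q"] w that by simp
  qed
  then have "shift A l Map.empty g = shift A l (q ++ p) g"
    by (simp add: shift_eq_iff)
  with p m show False
    by (auto simp: P_def)
qed

end

theorem theorem5p2:
  fixes A :: "'a set" and C :: "'c set" and f :: "(nat \<rightharpoonup> 'a) \<Rightarrow> 'c"
  assumes "finite A" and "A \<noteq> {}"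
    and "finite C" and "C \<noteq> {}"
    and "f \<in> colorings A C"
  shows "\<exists>g \<in> colorings A C. uniformly_recurrent A g \<and> weakly_proximal A g f"
proof -
  interpret finite_coloring A C
    using assms by unfold_locales
  obtain L where L: "closedin (subtopology map_topology ellis) L" "L \<noteq> {}"
    and ideal: "\<And>s u. s \<in> ellis \<Longrightarrow> u \<in> L \<Longrightarrow> compose X s u \<in> L"
    and minimal: "\<And>u. u \<in> L \<Longrightarrow> (\<lambda>s. compose X s u) ` ellis = L"
    using ellis.minimal_left_ideal_exists ellis_nonempty unfolding topspace_ellis by metis
  have "L \<subseteq> ellis"
    using closedin_subset[OF L(1)] by (simp add: topspace_ellis)
  \<comment> \<open>A left ideal inside \<open>ellis\<close> is closed under products, so the
    idempotent can be found in \<open>L\<close> itself.\<close>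
  with L ideal obtain u where u: "u \<in> L" "compose X u u = u"
    using ellis.idempotent_exists[of L] by blast
  have "u \<in> ellis"
    using u \<open>L \<subseteq> ellis\<close> by blast
  have "\<exists>w\<in>ellis. w (v (u f)) = u f" if "v \<in> ellis" for v
  proof -
    \<comment> \<open>The product \<open>compose X v u\<close> is again in \<open>L\<close>, so its
      left multiples fill \<open>L\<close> and reach \<open>u\<close>. Evaluation at
      \<open>f\<close> then returns \<open>v (u f)\<close> to \<open>u f\<close>.\<close>
    have "u \<in> (\<lambda>s. compose X s (compose X v u)) ` ellis"
      using minimal[OF ideal[OF that u(1)]] u(1) by simp
    then obtain w where "w \<in> ellis" "u = compose X w (compose X v u)"
      by blast
    then show ?thesis
      using assms(5) by (metis compose_eq)
  qed
  moreover have "u f \<in> X"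
    using \<open>u \<in> ellis\<close> ellis_subset assms(5) by auto
  ultimately show ?thesis
    using uniformly_recurrent_if_returns weakly_proximal_idempotent \<open>u \<in> ellis\<close> u(2) assms(5)
    by blast
qed

end
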